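(* For an integer $p \geq 0$, let $N^{\mathrm{even}}_2(3,p)$ (resp. $N^{\mathrm{odd}}_2(3,p)$) denote the maximum number of vertices of a connected subgraph $S$ of the infinite $2$-dimensional mesh such that every vertex of $S$ has degree at most $3$ in $S$ and the diameter of $S$ is at most $D = 2p$ (resp. $D = 2p+1$). Then: \begin{itemize} \item for every integer $p \geq 0$: $\;2p^2 - 2p + 1 \leq N^{\mathrm{even}}_2(3,p) \leq 2p^2 + 2p + 1$; \item if $p = 2r$ (so $D = 4r+1$) with $r \geq 0$ an integer: $\;8r^2 + 2r = 2p^2 + p \leq N^{\mathrm{odd}}_2(3,p) \leq 2p^2 + 4p + 2$; \item if $p = 2r+1$ (so $D = 4r+3$) with $r \geq 0$ an integer: $\;8r^2 + 10r + 6 = 2p^2 + p + 3 \leq N^{\mathrm{odd}}_2(3,p) \leq 2p^2 + 4p + 2$. \end{itemize}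
   Context: The infinite $2$-dimensional mesh is the graph with vertex set $\mathbb{Z}^2$ in which two vertices are adjacent iff their $L^1$ distance is $1$. A subgraph need not be induced; the diameter of $S$ is measured with respect to distances in $S$ itself. *)

theory Defs
  imports "Graph_Theory.Graph_Theory"
begin

text \<open>
  As usual in this library, an undirected graph is a symmetric digraph: an edge is a pair of
  opposite arcs, and the degree of a vertex is its out-degree.
\<close>

definition mesh2 :: "(int \<times> int) pair_pre_digraph" where
  "mesh2 = \<lparr> pverts = UNIV, parcs = {((a, b), (c, d)). \<bar>a - c\<bar> + \<bar>b - d\<bar> = 1} \<rparr>"

definition graph_dist :: "('a, 'b) pre_digraph \<Rightarrow> 'a \<Rightarrow> 'a \<Rightarrow> ereal" where
  "graph_dist G u v = wf_digraph.\<mu> G (\<lambda>_. 1) u v"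

definition graph_diameter :: "('a, 'b) pre_digraph \<Rightarrow> ereal" where
  "graph_diameter G = (SUP u \<in> verts G. SUP v \<in> verts G. graph_dist G u v)"

text \<open>
  The qualified name avoids the topological notion \<open>connected\<close>; the graph-theoretic one requires
  at least one vertex. No finiteness of \<open>S\<close> is imposed: it follows from the bound on the diameter.
\<close>

definition mesh2_bounded_subgraph :: "nat \<Rightarrow> nat \<Rightarrow> (int \<times> int) pair_pre_digraph \<Rightarrow> bool" where
  "mesh2_bounded_subgraph \<Delta> D S \<longleftrightarrow>
     subgraph (with_proj S) (with_proj mesh2) \<and>
     symmetric (with_proj S) \<and>
     Digraph_Component.connected (with_proj S) \<and>
     (\<forall>v \<in> pverts S. out_degree (with_proj S) v \<le> \<Delta>) \<and>
     graph_diameter (with_proj S) \<le> ereal (real D)"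

definition mesh2_max_order :: "nat \<Rightarrow> nat \<Rightarrow> nat" where
  "mesh2_max_order \<Delta> D = Max {card (pverts S) | S. mesh2_bounded_subgraph \<Delta> D S}"

definition N2_even :: "nat \<Rightarrow> nat \<Rightarrow> nat" where
  "N2_even \<Delta> p = mesh2_max_order \<Delta> (2 * p)"

definition N2_odd :: "nat \<Rightarrow> nat \<Rightarrow> nat" where
  "N2_odd \<Delta> p = mesh2_max_order \<Delta> (2 * p + 1)"

end

theory Submission
  imports Defs
begin

text \<open>
  For the upper bounds, distances in a subgraph of the mesh dominate \<open>L\<^sup>1\<close> distances, so in the
  coordinates \<open>u = x + y\<close>, \<open>v = x - y\<close> the vertices lie in a square of side \<open>D\<close>; as \<open>u\<close> and \<open>v\<close>
  have the same parity, only about half of its lattice points can occur.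

  For the lower bounds, join the two vertices \<open>(0,0)\<close> and \<open>(0,1)\<close> by an edge. Row \<open>0\<close> is a
  spine from which columns hang downwards, row \<open>1\<close> a spine from which columns rise upwards, and
  every vertex at depth at most \<open>p\<close> below its root is kept. Omitting the two columns at the roots
  keeps all degrees at most \<open>3\<close>. This tree has \<open>2p\<^sup>2 + 2p + 2\<close> vertices and diameter at most
  \<open>2p + 1\<close>, which suffices for \<open>D = 2p + 1\<close> and, one step later, for \<open>D = 2p + 2\<close>.
\<close>

subsection \<open>Distances\<close>

lemma awalk_cost_unit:
  fixes G :: "('a, 'b) pre_digraph" and p :: "'b awalk"
  assumes "wf_digraph G"
  shows "wf_digraph.awalk_cost (\<lambda>_. 1) p = real (length p)"
  by (induction p) (simp_all add: wf_digraph.awalk_cost_def[OF assms])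

lemma graph_dist_le_length:
  assumes "wf_digraph G" "pre_digraph.awalk G u p v"
  shows "graph_dist G u v \<le> ereal (real (length p))"
  using wf_digraph.min_cost_le_walk_cost[OF assms, of "\<lambda>_. 1"] assms(1)
  by (simp add: graph_dist_def awalk_cost_unit[OF assms(1)])

definition l1_dist :: "int \<times> int \<Rightarrow> int \<times> int \<Rightarrow> int" where
  "l1_dist u v = \<bar>fst u - fst v\<bar> + \<bar>snd u - snd v\<bar>"

lemma l1_dist_triangle: "l1_dist u w \<le> l1_dist u v + l1_dist v w"
  unfolding l1_dist_def by linarith

text \<open>Every arc of the mesh moves by L1 distance exactly 1, so the triangle inequality adds up
  along the walk.\<close>

lemma l1_dist_le_awalk_length:
  assumes sub: "subgraph (with_proj S) (with_proj mesh2)"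
    and walk: "pre_digraph.awalk (with_proj S) u p v"
  shows "l1_dist u v \<le> int (length p)"
  using walk
proof (induction p arbitrary: u)
  case Nil
  then show ?case by (simp add: pre_digraph.awalk_def pre_digraph.cas.simps l1_dist_def)
next
  case (Cons e p)
  have wf: "wf_digraph (with_proj S)"
    using sub by (simp add: subgraph_def)
  have e: "e \<in> parcs S" "fst e = u" "pre_digraph.awalk (with_proj S) (snd e) p v"
    using Cons.prems by (auto simp: wf_digraph.awalk_Cons_iff[OF wf])
  then have "e \<in> parcs mesh2"
    using sub by (auto simp: subgraph_def)
  then have "l1_dist u (snd e) = 1"
    using e(2) by (auto simp: mesh2_def l1_dist_def)
  then show ?case
    using Cons.IH[OF e(3)] l1_dist_triangle[of u v "snd e"] by simp
qed

lemma l1_dist_le_graph_dist: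
  assumes "subgraph (with_proj S) (with_proj mesh2)"
  shows "ereal (real_of_int (l1_dist u v)) \<le> graph_dist (with_proj S) u v"
proof -
  have wf: "wf_digraph (with_proj S)"
    using assms by (simp add: subgraph_def)
  show ?thesis
    unfolding graph_dist_def wf_digraph.\<mu>_def[OF wf]
  proof (rule INF_greatest)
    fix p assume "p \<in> {p. pre_digraph.awalk (with_proj S) u p v}"
    then have "l1_dist u v \<le> int (length p)"
      using l1_dist_le_awalk_length[OF assms] by simp
    then have "real_of_int (l1_dist u v) \<le> real (length p)"
      by linarith
    then show "ereal (real_of_int (l1_dist u v)) \<le> ereal (wf_digraph.awalk_cost (\<lambda>_. 1) p)"
      by (simp add: awalk_cost_unit[OF wf])
  qed
qed

lemma mesh2_bounded_subgraph_l1_dist_le: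
  assumes "mesh2_bounded_subgraph \<Delta> D S" "u \<in> pverts S" "v \<in> pverts S"
  shows "l1_dist u v \<le> int D"
proof -
  have "ereal (real_of_int (l1_dist u v)) \<le> graph_dist (with_proj S) u v"
    using assms(1) by (intro l1_dist_le_graph_dist) (simp add: mesh2_bounded_subgraph_def)
  also have "\<dots> \<le> graph_diameter (with_proj S)"
    unfolding graph_diameter_def using assms(2,3)
    by (intro SUP_upper2[of u] SUP_upper[of v]) simp_all
  also have "\<dots> \<le> ereal (real D)"
    using assms(1) by (simp add: mesh2_bounded_subgraph_def)
  finally show ?thesis by simp
qed

subsection \<open>Lattice sets of bounded diameter\<close>

text \<open>Both x + y and x - y are 1-Lipschitz for \<open>l1_dist\<close>. Each attains a minimum
  on \<open>V\<close>, and comparing any point with a minimiser shows that the values exceed this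
  minimum by at most \<open>D\<close>.\<close>

lemma l1_diameter_rotated_box:
  fixes V :: "(int \<times> int) set"
  assumes ne: "V \<noteq> {}" and diam: "\<And>u v. u \<in> V \<Longrightarrow> v \<in> V \<Longrightarrow> l1_dist u v \<le> int D"
  obtains m n where "\<And>x y. (x, y) \<in> V \<Longrightarrow> x + y - m \<in> {0..int D} \<and> x - y - n \<in> {0..int D}"
proof -
  have low: "\<exists>m. (\<exists>v\<in>V. f v = m) \<and> (\<forall>v\<in>V. m \<le> f v)"
    if f: "\<And>u v. f u - f v \<le> l1_dist u v" for f :: "int \<times> int \<Rightarrow> int"
  proof -
    obtain w where w: "w \<in> V" using ne by blast
    \<comment> \<open>\<open>V\<close> is not assumed finite, so the minimum comes from
      well-ordering of the naturals. Since \<open>f\<close> stays above \<open>f w - int D\<close>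
      on \<open>V\<close>, the shifted values are nonnegative and \<open>nat\<close> preserves their
      order.\<close>
    define k where "k = (LEAST k. \<exists>v\<in>V. nat (f v - (f w - int D)) = k)"
    have "\<exists>v\<in>V. nat (f v - (f w - int D)) = k"
      unfolding k_def by (rule LeastI_ex) (use w in blast)
    then obtain v where v: "v \<in> V" "nat (f v - (f w - int D)) = k" by blast
    have ge: "f w - int D \<le> f u" if "u \<in> V" for u
      using f[of w u] diam[OF w that] by linarith
    have "f v \<le> f u" if u: "u \<in> V" for u
    proof -
      have "k \<le> nat (f u - (f w - int D))"
        unfolding k_def by (rule Least_le) (use u in blast)
      then show ?thesis using v ge[OF u] ge[OF v(1)] by linarith
    qed
    then show ?thesis using v(1) by blast
  qed
  obtain m where m: "\<exists>v\<in>V. fst v + snd v = m" "\<forall>v\<in>V. m \<le> fst v + snd v"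
    using low[of "\<lambda>v. fst v + snd v"] by (force simp: l1_dist_def)
  obtain n where n: "\<exists>v\<in>V. fst v - snd v = n" "\<forall>v\<in>V. n \<le> fst v - snd v"
    using low[of "\<lambda>v. fst v - snd v"] by (force simp: l1_dist_def)
  show ?thesis
  proof (rule that[of m n])
    fix x y assume xy: "(x, y) \<in> V"
    obtain a where a: "a \<in> V" "fst a + snd a = m" using m by blast
    obtain b where b: "b \<in> V" "fst b - snd b = n" using n by blast
    have "x + y - m \<le> int D"
      using diam[OF xy a(1)] a(2) by (simp add: l1_dist_def)
    moreover have "x - y - n \<le> int D"
      using diam[OF xy b(1)] b(2) by (simp add: l1_dist_def)
    ultimately show "x + y - m \<in> {0..int D} \<and> x - y - n \<in> {0..int D}"
      using m(2) n(2) xy by force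
  qed
qed

text \<open>The rotated box has q^2 points with q = 2p + 1. Numbered from 0 to q^2 - 1, at most (q^2
  + 1) / 2 of them share a parity, which is the bound.\<close>

lemma card_l1_diameter_even:
  fixes V :: "(int \<times> int) set"
  assumes ne: "V \<noteq> {}" and diam: "\<And>u v. u \<in> V \<Longrightarrow> v \<in> V \<Longrightarrow> l1_dist u v \<le> int (2 * p)"
  shows "card V \<le> 2 * p\<^sup>2 + 2 * p + 1"
proof -
  obtain m n where box:
    "\<And>x y. (x, y) \<in> V \<Longrightarrow> x + y - m \<in> {0..int (2 * p)} \<and> x - y - n \<in> {0..int (2 * p)}"
    using l1_diameter_rotated_box[OF ne diam] by metis
  define q where "q = 2 * int p + 1"
  \<comment> \<open>Row-major numbering of the box: as \<open>q\<close> is odd, all numbers that occur have the same parity.\<close>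
  define f where "f = (\<lambda>(x, y). q * (x + y - m) + (x - y - n))"
  have q: "q > 0" "odd q" by (auto simp: q_def)
  have par: "even (f v) \<longleftrightarrow> even (m + n)" for v
    using q(2) by (cases v) (auto simp: f_def)
  \<comment> \<open>The offset x - y - n is at most 2p, hence below \<open>q\<close>, so quotient
    and remainder recover both coordinates.\<close>
  have div: "f v div q = fst v + snd v - m" "f v mod q = fst v - snd v - n" if "v \<in> V" for v
    using box[of "fst v" "snd v"] that q by (auto simp: f_def q_def case_prod_beta)
  have inj: "inj_on (\<lambda>v. f v div 2) V"
  proof (rule inj_onI)
    fix u v assume uv: "u \<in> V" "v \<in> V" "f u div 2 = f v div 2"
    have "even (f u) \<longleftrightarrow> even (f v)" using par by simp
    then have "f u = f v" using uv(3) by presburger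
    then have "fst u + snd u = fst v + snd v" "fst u - snd u = fst v - snd v"
      using div[OF uv(1)] div[OF uv(2)] by auto
    then show "u = v" by (intro prod_eqI) linarith+
  qed
  have "(\<lambda>v. f v div 2) ` V \<subseteq> {0..2 * (int p)\<^sup>2 + 2 * int p}"
  proof
    fix k assume "k \<in> (\<lambda>v. f v div 2) ` V"
    then obtain x y where k: "k = f (x, y) div 2" and xy: "(x, y) \<in> V" by auto
    have "q * (x + y - m) \<le> q * (2 * int p)" "0 \<le> q * (x + y - m)"
      using box[OF xy] q by (auto intro!: mult_left_mono)
    then have "0 \<le> f (x, y)" "f (x, y) \<le> q * (2 * int p) + 2 * int p"
      using box[OF xy] by (auto simp: f_def)
    moreover have "q * (2 * int p) + 2 * int p = 2 * (2 * (int p)\<^sup>2 + 2 * int p)"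
      by (simp add: q_def power2_eq_square algebra_simps)
    ultimately show "k \<in> {0..2 * (int p)\<^sup>2 + 2 * int p}"
      unfolding k by auto
  qed
  then have "card V \<le> card {0..2 * (int p)\<^sup>2 + 2 * int p}"
    by (intro card_inj_on_le[OF inj]) auto
  also have "\<dots> = nat (int (2 * p\<^sup>2 + 2 * p + 1))" by simp
  finally show ?thesis unfolding nat_int .
qed

text \<open>Here the side 2p + 2 of the box is even. Each of the 2p + 2 values of x + y fixes the
  parity of x - y, leaving p + 1 choices.\<close>

lemma card_l1_diameter_odd:
  fixes V :: "(int \<times> int) set"
  assumes ne: "V \<noteq> {}" and diam: "\<And>u v. u \<in> V \<Longrightarrow> v \<in> V \<Longrightarrow> l1_dist u v \<le> int (2 * p + 1)"
  shows "card V \<le> 2 * p\<^sup>2 + 4 * p + 2"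
proof -
  obtain m n where box:
    "\<And>x y. (x, y) \<in> V \<Longrightarrow> x + y - m \<in> {0..int (2 * p + 1)} \<and> x - y - n \<in> {0..int (2 * p + 1)}"
    using l1_diameter_rotated_box[OF ne diam] by metis
  define f where "f = (\<lambda>(x, y). (x + y - m, (x - y - n) div 2))"
  have inj: "inj_on f V"
  proof (rule inj_onI)
    fix u v assume "f u = f v"
    then have "fst u + snd u = fst v + snd v"
      "(fst u - snd u - n) div 2 = (fst v - snd v - n) div 2"
      by (auto simp: f_def case_prod_beta)
    \<comment> \<open>Equal sums force differences of equal parity, so equal halves force equal
      differences.\<close>
    then have "fst u = fst v" "snd u = snd v" by presburger+
    then show "u = v" by (rule prod_eqI)
  qed
  have "f ` V \<subseteq> {0..2 * int p + 1} \<times> {0..int p}"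
    using box by (force simp: f_def)
  then have "card V \<le> card ({0..2 * int p + 1} \<times> {0..int p})"
    by (intro card_inj_on_le[OF inj]) auto
  also have "\<dots> = nat (int (2 * p + 2)) * nat (int (p + 1))"
    by (simp add: card_cartesian_product algebra_simps)
  also have "\<dots> = 2 * p\<^sup>2 + 4 * p + 2"
    unfolding nat_int by (simp add: power2_eq_square algebra_simps)
  finally show ?thesis .
qed

section \<open>Bounds on the maximum order\<close>

lemma mesh2_bounded_subgraph_nonempty: "mesh2_bounded_subgraph \<Delta> D S \<Longrightarrow> pverts S \<noteq> {}"
  by (auto simp: mesh2_bounded_subgraph_def Digraph_Component.connected_def
      strongly_connected_def mk_symmetric_def)

lemma mesh2_bounded_subgraph_card_even:
  assumes "mesh2_bounded_subgraph \<Delta> (2 * p) S"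
  shows "card (pverts S) \<le> 2 * p\<^sup>2 + 2 * p + 1"
  using card_l1_diameter_even mesh2_bounded_subgraph_nonempty[OF assms]
    mesh2_bounded_subgraph_l1_dist_le[OF assms] by blast

lemma mesh2_bounded_subgraph_card_odd:
  assumes "mesh2_bounded_subgraph \<Delta> (2 * p + 1) S"
  shows "card (pverts S) \<le> 2 * p\<^sup>2 + 4 * p + 2"
  using card_l1_diameter_odd mesh2_bounded_subgraph_nonempty[OF assms]
    mesh2_bounded_subgraph_l1_dist_le[OF assms] by blast

text \<open>\<open>Max\<close> is meaningful only on a finite nonempty set: the bound
  \<open>M\<close> provides finiteness and the witness \<open>T\<close> nonemptiness.\<close>

lemma mesh2_max_order_bounds:
  assumes "\<And>S. mesh2_bounded_subgraph \<Delta> D S \<Longrightarrow> card (pverts S) \<le> M"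
    and "mesh2_bounded_subgraph \<Delta> D T"
  shows "card (pverts T) \<le> mesh2_max_order \<Delta> D" "mesh2_max_order \<Delta> D \<le> M"
proof -
  let ?C = "{card (pverts S) | S. mesh2_bounded_subgraph \<Delta> D S}"
  have fin: "finite ?C"
    by (rule finite_subset[of _ "{..M}"]) (use assms(1) in auto)
  have T: "card (pverts T) \<in> ?C" using assms(2) by blast
  show "card (pverts T) \<le> mesh2_max_order \<Delta> D"
    unfolding mesh2_max_order_def using Max_ge[OF fin T] .
  have "Max ?C \<in> ?C" using Max_in[OF fin] T by blast
  then show "mesh2_max_order \<Delta> D \<le> M"
    unfolding mesh2_max_order_def using assms(1) by auto
qed

subsection \<open>The double comb\<close>

lemma wf_mesh2: "wf_digraph (with_proj mesh2)"
  by (simp add: wf_digraph_def mesh2_def)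

text \<open>The hypothesis on short walks serves twice: it gives connectedness and bounds the
  diameter.\<close>

lemma mesh2_bounded_subgraphI:
  assumes wf: "wf_digraph (with_proj S)"
    and sub: "parcs S \<subseteq> parcs mesh2"
    and sym: "sym (parcs S)"
    and ne: "pverts S \<noteq> {}"
    and deg: "\<And>v. v \<in> pverts S \<Longrightarrow> out_degree (with_proj S) v \<le> \<Delta>"
    and walk: "\<And>u v. u \<in> pverts S \<Longrightarrow> v \<in> pverts S \<Longrightarrow>
      \<exists>p. pre_digraph.awalk (with_proj S) u p v \<and> length p \<le> D"
  shows "mesh2_bounded_subgraph \<Delta> D S"
proof -
  have "Digraph_Component.connected (with_proj S)"
  proof (rule wf_digraph.connectedI[OF wf])
    fix u v assume "u \<in> verts (with_proj S)" "v \<in> verts (with_proj S)"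
    then show "u \<rightarrow>\<^sup>*\<^bsub>mk_symmetric (with_proj S)\<^esub> v"
      using walk[of u v] by (intro wf_digraph.reachable_mk_symmetricI[OF wf])
        (auto simp: wf_digraph.reachable_awalk[OF wf])
  qed (use ne in simp)
  moreover have "graph_dist (with_proj S) u v \<le> ereal (real D)"
    if uv: "u \<in> pverts S" "v \<in> pverts S" for u v
  proof -
    obtain p where p: "pre_digraph.awalk (with_proj S) u p v" "length p \<le> D"
      using walk[OF uv] by blast
    have "ereal (real (length p)) \<le> ereal (real D)" using p(2) by simp
    with graph_dist_le_length[OF wf p(1)] show ?thesis by (rule order_trans)
  qed
  then have "graph_diameter (with_proj S) \<le> ereal (real D)"
    unfolding graph_diameter_def by (auto intro!: SUP_least)
  moreover have "subgraph (with_proj S) (with_proj mesh2)"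
    using wf wf_mesh2 sub by (auto simp: subgraph_def compatible_def mesh2_def)
  ultimately show ?thesis
    using sym deg by (simp add: mesh2_bounded_subgraph_def symmetric_def)
qed

text \<open>This is the L1 distance from \<open>v\<close> to \<open>comb_root v\<close>;
  \<open>comb_walk_root\<close> realises it by walks in the comb.\<close>

definition comb_depth :: "int \<times> int \<Rightarrow> int" where
  "comb_depth v = \<bar>fst v\<bar> + (if snd v \<le> 0 then - snd v else snd v - 1)"

definition comb_root :: "int \<times> int \<Rightarrow> int \<times> int" where
  "comb_root v = (0, if snd v \<le> 0 then 0 else 1)"

definition comb_verts :: "nat \<Rightarrow> (int \<times> int) set" where
  "comb_verts p = {v. (fst v = 0 \<longrightarrow> snd v \<in> {0, 1}) \<and> comb_depth v \<le> int p}"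

text \<open>
  The condition \<open>b + d = 1\<close> singles out the vertical edges between the two spines.
\<close>

definition comb_edge :: "int \<times> int \<Rightarrow> int \<times> int \<Rightarrow> bool" where
  "comb_edge = (\<lambda>(a, b) (c, d).
     \<bar>a - c\<bar> = 1 \<and> b = d \<and> b \<in> {0, 1} \<or> a = c \<and> \<bar>b - d\<bar> = 1 \<and> (a = 0 \<longleftrightarrow> b + d = 1))"

definition double_comb :: "nat \<Rightarrow> (int \<times> int) pair_pre_digraph" where
  "double_comb p = \<lparr> pverts = comb_verts p,
     parcs = {(u, v). u \<in> comb_verts p \<and> v \<in> comb_verts p \<and> comb_edge u v} \<rparr>"

lemma double_comb_simps [simp]:
  "pverts (double_comb p) = comb_verts p"
  "(u, v) \<in> parcs (double_comb p) \<longleftrightarrow> u \<in> comb_verts p \<and> v \<in> comb_verts p \<and> comb_edge u v"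
  by (auto simp: double_comb_def)

lemma wf_double_comb: "wf_digraph (with_proj (double_comb p))"
  by (auto simp: wf_digraph_def double_comb_def)

lemma comb_edge_sym: "comb_edge u v \<Longrightarrow> comb_edge v u"
  by (auto simp: comb_edge_def split: prod.splits)

text \<open>The parent is one step along the column towards its spine or, for a vertex on a spine,
  one step along the spine towards the root.\<close>

lemma comb_parent:
  assumes "v \<in> comb_verts p" "comb_depth v > 0"
  shows "\<exists>w \<in> comb_verts p. comb_edge v w \<and> comb_depth w = comb_depth v - 1 \<and>
    comb_root w = comb_root v"
proof (cases v)
  case (Pair x y)
  consider "y \<in> {0, 1}" | "y < 0" | "y > 1" by fastforce
  then show ?thesis
  proof cases
    case 1
    with assms Pair show ?thesis
      \<comment> \<open>On a spine, positive depth means that \<open>x\<close> is nonzero, so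
        subtracting \<open>sgn x\<close> does move towards the root.\<close>
      by (intro bexI[of _ "(x - sgn x, y)"])
        (auto simp: comb_verts_def comb_edge_def comb_depth_def comb_root_def sgn_if)
  next
    case 2
    with assms Pair show ?thesis
      by (intro bexI[of _ "(x, y + 1)"])
        (auto simp: comb_verts_def comb_edge_def comb_depth_def comb_root_def)
  next
    case 3
    with assms Pair show ?thesis
      by (intro bexI[of _ "(x, y - 1)"])
        (auto simp: comb_verts_def comb_edge_def comb_depth_def comb_root_def)
  qed
qed

lemma comb_root_in_verts: "comb_root v \<in> comb_verts p"
  by (auto simp: comb_verts_def comb_depth_def comb_root_def)

lemma comb_depth_nonneg: "comb_depth v \<ge> 0"
  by (auto simp: comb_depth_def)

lemma comb_depth_zero: "v \<in> comb_verts p \<Longrightarrow> comb_depth v = 0 \<Longrightarrow> v = comb_root v"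
  by (cases v) (auto simp: comb_verts_def comb_depth_def comb_root_def split: if_splits)

section \<open>Short walks and degrees in the double comb\<close>

abbreviation comb_walk where
  "comb_walk p \<equiv> pre_digraph.awalk (with_proj (double_comb p))"

lemma comb_walk_append: "comb_walk p u q v \<Longrightarrow> comb_walk p v r w \<Longrightarrow> comb_walk p u (q @ r) w"
  by (rule wf_digraph.awalk_appendI[OF wf_double_comb])

lemma comb_walk_edge:
  "u \<in> comb_verts p \<Longrightarrow> v \<in> comb_verts p \<Longrightarrow> comb_edge u v \<Longrightarrow> comb_walk p u [(u, v)] v"
  by (simp add: pre_digraph.awalk_def pre_digraph.cas.simps)

text \<open>Iterating \<open>comb_parent\<close> leads to the root in \<open>comb_depth v\<close>
  steps. Walks are directed, so the way back is built in the same induction.\<close>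

lemma comb_walk_root:
  assumes "v \<in> comb_verts p"
  shows "\<exists>q r. comb_walk p v q (comb_root v) \<and> comb_walk p (comb_root v) r v \<and>
    int (length q) = comb_depth v \<and> int (length r) = comb_depth v"
  using assms
proof (induction "nat (comb_depth v)" arbitrary: v)
  case 0
  then have "comb_depth v = 0" using comb_depth_nonneg[of v] by linarith
  then have "comb_walk p v [] (comb_root v)" "comb_walk p (comb_root v) [] v"
    using comb_depth_zero[OF 0(2)] 0(2) by (auto simp: pre_digraph.awalk_def pre_digraph.cas.simps)
  with \<open>comb_depth v = 0\<close> show ?case by fastforce
next
  case (Suc n)
  then have "comb_depth v > 0" by linarith
  from comb_parent[OF Suc.prems this] obtain w where w: "w \<in> comb_verts p" "comb_edge v w"
    "comb_depth w = comb_depth v - 1" "comb_root w = comb_root v" by blast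
  then have "n = nat (comb_depth w)" using Suc.hyps(2) by linarith
  from Suc.hyps(1)[OF this w(1)] obtain q r where qr: "comb_walk p w q (comb_root v)"
    "comb_walk p (comb_root v) r w"
    "int (length q) = comb_depth v - 1" "int (length r) = comb_depth v - 1"
    using w by auto
  have "comb_walk p v ([(v, w)] @ q) (comb_root v)"
    using comb_walk_append[OF comb_walk_edge qr(1)] Suc.prems w by blast
  moreover have "comb_walk p (comb_root v) (r @ [(w, v)]) v"
    using comb_walk_append[OF qr(2) comb_walk_edge] Suc.prems w comb_edge_sym by blast
  ultimately show ?case using qr(3,4)
    by (intro exI[of _ "[(v, w)] @ q"] exI[of _ "r @ [(w, v)]"]) auto
qed

lemma comb_walk_roots: "\<exists>q. comb_walk p (comb_root u) q (comb_root v) \<and> length q \<le> 1"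
proof (cases "comb_root u = comb_root v")
  case True
  then have "comb_walk p (comb_root u) [] (comb_root v)"
    by (simp add: pre_digraph.awalk_def pre_digraph.cas.simps comb_root_in_verts)
  then show ?thesis by fastforce
next
  case False
  then have "comb_edge (comb_root u) (comb_root v)"
    by (auto simp: comb_edge_def comb_root_def split: if_splits)
  then have "comb_walk p (comb_root u) [(comb_root u, comb_root v)] (comb_root v)"
    by (intro comb_walk_edge comb_root_in_verts)
  then show ?thesis by fastforce
qed

text \<open>Go up to the root, cross to the other root if necessary, and descend: at most p + 1 + p
  arcs.\<close>

lemma comb_walk_bounded:
  assumes "u \<in> comb_verts p" "v \<in> comb_verts p"
  shows "\<exists>q. comb_walk p u q v \<and> length q \<le> 2 * p + 1"
proof -
  obtain q1 where q1: "comb_walk p u q1 (comb_root u)" "int (length q1) = comb_depth u"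
    using comb_walk_root[OF assms(1)] by blast
  obtain q2 where q2: "comb_walk p (comb_root u) q2 (comb_root v)" "length q2 \<le> 1"
    using comb_walk_roots by blast
  obtain q3 where q3: "comb_walk p (comb_root v) q3 v" "int (length q3) = comb_depth v"
    using comb_walk_root[OF assms(2)] by blast
  have "comb_walk p u (q1 @ q2 @ q3) v"
    using q1(1) q2(1) q3(1) by (intro comb_walk_append)
  moreover have "comb_depth u \<le> int p" "comb_depth v \<le> int p"
    using assms by (auto simp: comb_verts_def)
  then have "length (q1 @ q2 @ q3) \<le> 2 * p + 1"
    using q1(2) q2(2) q3(2) by simp
  ultimately show ?thesis by blast
qed

lemma out_degree_double_comb:
  assumes "v \<in> comb_verts p"
  shows "out_degree (with_proj (double_comb p)) v \<le> 3"
proof -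
  obtain x y where v: "v = (x, y)" by (cases v)
  \<comment> \<open>A spine vertex has one vertical neighbour at most: the other root if
    \<open>x = 0\<close>, and otherwise the one pointing away from the other spine. Its height 3y -
    1 is -1 for \<open>y = 0\<close> and 2 for \<open>y = 1\<close>.\<close>
  let ?N = "if y \<in> {0, 1} then [(x - 1, y), (x + 1, y), (x, if x = 0 then 1 - y else 3 * y - 1)]
    else [(x, y - 1), (x, y + 1)]"
  have "out_arcs (with_proj (double_comb p)) v \<subseteq> Pair v ` set ?N"
  proof
    fix e assume e: "e \<in> out_arcs (with_proj (double_comb p)) v"
    obtain c d where cd: "e = (v, (c, d))"
      using e by (cases e) (auto simp: out_arcs_def)
    then have edge: "comb_edge (x, y) (c, d)"
      using e by (simp add: out_arcs_def v)
    have "x = 0 \<Longrightarrow> y \<in> {0, 1}"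
      using assms by (simp add: comb_verts_def v)
    then consider "y = 0" "x = 0" | "y = 0" "x \<noteq> 0" | "y = 1" "x = 0" | "y = 1" "x \<noteq> 0"
      | "y \<notin> {0, 1}" "x \<noteq> 0" by blast
    then have "(c, d) \<in> set ?N"
      using edge by cases (simp_all add: comb_edge_def, linarith+)
    then show "e \<in> Pair v ` set ?N" unfolding cd by (rule imageI)
  qed
  then have "out_degree (with_proj (double_comb p)) v \<le> card (Pair v ` set ?N)"
    unfolding out_degree_def by (intro card_mono) auto
  also have "\<dots> \<le> card (set ?N)" by (intro card_image_le) auto
  also have "\<dots> \<le> length ?N" by (rule card_length)
  also have "\<dots> \<le> 3" by simp
  finally show ?thesis .
qed

lemma mesh2_bounded_subgraph_double_comb: "mesh2_bounded_subgraph 3 (2 * p + 1) (double_comb p)"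
proof (rule mesh2_bounded_subgraphI)
  show "parcs (double_comb p) \<subseteq> parcs mesh2"
    by (auto simp: double_comb_def mesh2_def comb_edge_def)
  show "sym (parcs (double_comb p))"
    by (rule symI) (auto intro: comb_edge_sym)
  show "pverts (double_comb p) \<noteq> {}"
    using comb_root_in_verts by auto
  show "\<exists>q. comb_walk p u q v \<and> length q \<le> 2 * p + 1"
    if "u \<in> pverts (double_comb p)" "v \<in> pverts (double_comb p)" for u v
    using comb_walk_bounded that by simp
qed (simp_all add: wf_double_comb out_degree_double_comb)

section \<open>Counting the vertices of the double comb\<close>

lemma sum_abs_symmetric:
  fixes g :: "int \<Rightarrow> nat"
  shows "(\<Sum>x = - int p..int p. g \<bar>x\<bar>) = g 0 + 2 * (\<Sum>k = 1..p. g (int k))"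
proof (induction p)
  case (Suc p)
  have "{- int (Suc p)..int (Suc p)} = insert (- int (Suc p)) (insert (int (Suc p)) {- int p..int p})"
    by auto
  then show ?case using Suc by (simp add: add.commute)
qed simp

lemma card_comb_verts: "card (comb_verts p) = 2 * p\<^sup>2 + 2 * p + 2"
proof -
  \<comment> \<open>\<open>?Y k\<close> is the set of heights in a column at distance
    \<open>k\<close> from the centre. For \<open>k\<close> from 1 to \<open>p\<close> it has 2(p + 1
    - k) elements; the central column keeps only the two roots.\<close>
  let ?Y = "\<lambda>k. if k = 0 then {0..1} else {- (int p - k)..int p - k + 1}"
  have "comb_verts p = (SIGMA x : {- int p..int p}. ?Y \<bar>x\<bar>)"
    by (auto simp: comb_verts_def comb_depth_def split: if_splits)
  then have "card (comb_verts p) = (\<Sum>x = - int p..int p. card (?Y \<bar>x\<bar>))"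
    by simp
  also have "\<dots> = card (?Y 0) + 2 * (\<Sum>k = 1..p. card (?Y (int k)))"
    by (rule sum_abs_symmetric)
  also have "(\<Sum>k = 1..p. card (?Y (int k))) = (\<Sum>k = 1..p. 2 * (p + 1 - k))"
    by (intro sum.cong) (auto simp: nat_eq_iff)
  also have "\<dots> = (\<Sum>k = 1..p. 2 * k)"
    by (rule sum.reindex_bij_witness[of _ "\<lambda>k. p + 1 - k" "\<lambda>k. p + 1 - k"]) auto
  also have "\<dots> = p * (p + 1)"
    by (induction p) auto
  finally show ?thesis by (simp add: power2_eq_square)
qed

section \<open>Assembling the bounds\<close>

lemma mesh2_bounded_subgraph_mono:
  assumes "mesh2_bounded_subgraph \<Delta> D S" "D \<le> E"
  shows "mesh2_bounded_subgraph \<Delta> E S"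
proof -
  have "graph_diameter (with_proj S) \<le> ereal (real D)"
    using assms(1) by (simp add: mesh2_bounded_subgraph_def)
  also have "\<dots> \<le> ereal (real E)" using assms(2) by simp
  finally show ?thesis using assms(1) by (simp add: mesh2_bounded_subgraph_def)
qed

text \<open>A subgraph admissible for every \<open>D\<close>: it makes the maximum well defined and
  settles the lower bound for \<open>D = 0\<close>.\<close>

lemma mesh2_bounded_subgraph_singleton:
  "mesh2_bounded_subgraph \<Delta> D \<lparr> pverts = {v}, parcs = {} \<rparr>"
  by (rule mesh2_bounded_subgraphI)
    (auto simp: wf_digraph_def out_degree_def out_arcs_def pre_digraph.awalk_def sym_def
      pre_digraph.cas.simps intro!: exI[of _ "[]"])

lemma N2_even_bounds:
  "2 * (int p)\<^sup>2 - 2 * int p + 1 \<le> int (N2_even 3 p)" (is ?lower)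
  "N2_even 3 p \<le> 2 * p\<^sup>2 + 2 * p + 1" (is ?upper)
proof -
  have bounds: "N2_even 3 p \<le> 2 * p\<^sup>2 + 2 * p + 1" "card (pverts S) \<le> N2_even 3 p"
    if "mesh2_bounded_subgraph 3 (2 * p) S" for S
    using mesh2_max_order_bounds[OF mesh2_bounded_subgraph_card_even that]
    by (simp_all add: N2_even_def)
  show ?upper
    by (rule bounds(1)[OF mesh2_bounded_subgraph_singleton])
  show ?lower
  proof (cases p)
    case 0
    have "card {(0::int, 0::int)} \<le> N2_even 3 p"
      using bounds(2)[OF mesh2_bounded_subgraph_singleton[where v = "(0, 0)"]] by simp
    then show ?thesis using 0 by simp
  next
    case (Suc q)
    \<comment> \<open>With p = q + 1 the comb's diameter bound 2q + 1 lies one below 2p. Its order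
      equals 2p^2 - 2p + 2, one more than required.\<close>
    have "mesh2_bounded_subgraph 3 (2 * p) (double_comb q)"
      by (rule mesh2_bounded_subgraph_mono[OF mesh2_bounded_subgraph_double_comb]) (simp add: Suc)
    from bounds(2)[OF this] have "2 * q\<^sup>2 + 2 * q + 2 \<le> N2_even 3 p"
      by (simp add: card_comb_verts)
    then have "int (2 * q\<^sup>2 + 2 * q + 2) \<le> int (N2_even 3 p)"
      by (simp only: of_nat_le_iff)
    then show ?thesis by (simp add: Suc power2_eq_square algebra_simps)
  qed
qed

text \<open>A single lower bound covers both parities of \<open>p\<close>.\<close>

lemma N2_odd_bounds:
  "2 * p\<^sup>2 + 2 * p + 2 \<le> N2_odd 3 p" "N2_odd 3 p \<le> 2 * p\<^sup>2 + 4 * p + 2"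
  using mesh2_max_order_bounds[OF mesh2_bounded_subgraph_card_odd
      mesh2_bounded_subgraph_double_comb, of p]
  by (simp_all add: N2_odd_def card_comb_verts)

theorem theorem4:
  shows "(\<forall>p::nat.
            2 * (int p)\<^sup>2 - 2 * int p + 1 \<le> int (N2_even 3 p) \<and>
            int (N2_even 3 p) \<le> 2 * (int p)\<^sup>2 + 2 * int p + 1) \<and>
         (\<forall>p r::nat. p = 2 * r \<longrightarrow>
            8 * r\<^sup>2 + 2 * r = 2 * p\<^sup>2 + p \<and>
            2 * p\<^sup>2 + p \<le> N2_odd 3 p \<and>
            N2_odd 3 p \<le> 2 * p\<^sup>2 + 4 * p + 2) \<and>
         (\<forall>p r::nat. p = 2 * r + 1 \<longrightarrow>
            8 * r\<^sup>2 + 10 * r + 6 = 2 * p\<^sup>2 + p + 3 \<and>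
            2 * p\<^sup>2 + p + 3 \<le> N2_odd 3 p \<and>
            N2_odd 3 p \<le> 2 * p\<^sup>2 + 4 * p + 2)"
proof (intro conjI allI impI)
  fix p :: nat
  show "2 * (int p)\<^sup>2 - 2 * int p + 1 \<le> int (N2_even 3 p)"
    by (rule N2_even_bounds)
  have "int (N2_even 3 p) \<le> int (2 * p\<^sup>2 + 2 * p + 1)"
    using N2_even_bounds(2) by (simp only: of_nat_le_iff)
  then show "int (N2_even 3 p) \<le> 2 * (int p)\<^sup>2 + 2 * int p + 1"
    by simp
next
  fix p r :: nat
  assume p: "p = 2 * r"
  show "8 * r\<^sup>2 + 2 * r = 2 * p\<^sup>2 + p"
    by (simp add: p power2_eq_square)
  show "2 * p\<^sup>2 + p \<le> N2_odd 3 p"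
    using N2_odd_bounds(1)[of p] by linarith
next
  fix p r :: nat
  assume p: "p = 2 * r + 1"
  show "8 * r\<^sup>2 + 10 * r + 6 = 2 * p\<^sup>2 + p + 3"
    by (simp add: p power2_eq_square)
  \<comment> \<open>Oddness gives p >= 1, hence 2p + 2 >= p + 3.\<close>
  show "2 * p\<^sup>2 + p + 3 \<le> N2_odd 3 p"
    using N2_odd_bounds(1)[of p] p by linarith
qed (rule N2_odd_bounds)+

end
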